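(* Let $X$ be a Fréchet–Urysohn space, $Y$ a regular topological space, $D$ a dense subset of $X$, and $f:D\to Y$ a continuous map. Then $f$ extends to a continuous map $\widetilde f:X\to Y$ if and only if for every sequence $\{x_n\}$ of points of $D$ that converges in $X$, the sequence $\{f(x_n)\}$ is convergent in $Y$.
   Context: A topological space $X$ is Fréchet–Urysohn if for every $A\subset X$ and every $x\in\overline{A}$ there is a sequence of points of $A$ converging to $x$. Regular spaces are assumed to be $T_1$ (hence Hausdorff), following Engelking's convention. *)

theory Defs
  imports "HOL-Analysis.Analysis"
begin

definition Frechet_Urysohn_space :: "'a topology \<Rightarrow> bool" where
  "Frechet_Urysohn_space X \<longleftrightarrow>
     (\<forall>A x. A \<subseteq> topspace X \<and> x \<in> X closure_of A \<longrightarrow>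
        (\<exists>s :: nat \<Rightarrow> 'a. range s \<subseteq> A \<and> limitin X s x sequentially))"

end

theory Submission
  imports Defs
begin

text \<open>
  A continuous extension preserves convergent sequences, which gives one direction.  For the other,
  the value of the extension at a point of \<open>X\<close> is forced: it must be the limit of \<open>f\<close> along any
  sequence of \<open>D\<close> converging to that point.  Such a sequence exists because \<open>D\<close> is dense and \<open>X\<close> is
  Frechet-Urysohn.  The limit does not depend on the sequence, since two sequences with the same
  limit can be interleaved into one convergent sequence, whose image must converge as well, and
  limits in the Hausdorff space \<open>Y\<close> are unique (\<open>sequential_limit_independent\<close>).  Constant
  sequences show that the map so defined agrees with \<open>f\<close> on \<open>D\<close>.  Regularity of \<open>Y\<close> makes the extension continuous (\<open>continuous_map_sequential_extension\<close>): its values near a point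
  are limits of nearby values of \<open>f\<close>, hence lie in the closure of a given neighbourhood, and in a
  regular space such closures can be made as small as required.
\<close>

lemma limitin_interleave:
  assumes "limitin X s a sequentially" and "limitin X t a sequentially"
  shows "limitin X (\<lambda>n. if even n then s (n div 2) else t (n div 2)) a sequentially"
  unfolding limitin_sequentially
proof (intro conjI allI impI)
  show "a \<in> topspace X"
    using assms(1) by (rule limitin_topspace)
next
  fix U
  assume "openin X U \<and> a \<in> U"
  then obtain M N where M: "\<And>n. M \<le> n \<Longrightarrow> s n \<in> U" and N: "\<And>n. N \<le> n \<Longrightarrow> t n \<in> U"
    using assms unfolding limitin_sequentially by meson
  have "(if even n then s (n div 2) else t (n div 2)) \<in> U" if "2 * max M N \<le> n" for n
  proof -
    have "M \<le> n div 2" and "N \<le> n div 2"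
      using that by auto
    then show ?thesis
      using M N by simp
  qed
  then show "\<exists>K. \<forall>n\<ge>K. (if even n then s (n div 2) else t (n div 2)) \<in> U"
    by blast
qed

text \<open>
  Both image sequences are subsequences of the image of the interleaved sequence, so both converge
  to its limit.
\<close>

lemma sequential_limit_independent:
  assumes "Hausdorff_space Y"
    and conv: "\<And>x a. range x \<subseteq> D \<Longrightarrow> limitin X x a sequentially \<Longrightarrow>
                 \<exists>b. limitin Y (\<lambda>n. f (x n)) b sequentially"
    and s: "range s \<subseteq> D" "limitin X s a sequentially"
    and t: "range t \<subseteq> D" "limitin X t a sequentially"
    and b: "limitin Y (\<lambda>n. f (s n)) b sequentially"
  shows "limitin Y (\<lambda>n. f (t n)) b sequentially"
proof -
  define u where "u n = (if even n then s (n div 2) else t (n div 2))" for n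
  have "limitin X u a sequentially"
    unfolding u_def using s(2) t(2) by (rule limitin_interleave)
  moreover have "range u \<subseteq> D"
    using s(1) t(1) by (auto simp: u_def)
  ultimately obtain c where c: "limitin Y (\<lambda>n. f (u n)) c sequentially"
    using conv by blast
  have "limitin Y ((\<lambda>n. f (u n)) \<circ> (\<lambda>n. 2 * n)) c sequentially"
    using c by (intro limitin_subsequence) (auto simp: strict_mono_def)
  then have "limitin Y (\<lambda>n. f (s n)) c sequentially"
    by (simp add: u_def o_def)
  then have "c = b"
    using b by (rule limitin_Hausdorff_unique[OF _ _ trivial_limit_sequentially assms(1)])
  moreover have "limitin Y ((\<lambda>n. f (u n)) \<circ> (\<lambda>n. 2 * n + 1)) c sequentially"
    using c by (intro limitin_subsequence) (auto simp: strict_mono_def)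
  then have "limitin Y (\<lambda>n. f (t n)) c sequentially"
    by (simp add: u_def o_def)
  ultimately show ?thesis
    by simp
qed

lemma Frechet_Urysohn_dense_sequence:
  assumes "Frechet_Urysohn_space X" and "D \<subseteq> topspace X" and "X closure_of D = topspace X"
    and "a \<in> topspace X"
  obtains s where "range s \<subseteq> D" and "limitin X s a sequentially"
  using assms unfolding Frechet_Urysohn_space_def by blast

text \<open>
  Given a neighbourhood of \<open>g a\<close>, regularity provides a smaller one, \<open>W\<close>, whose closure still lies
  inside.  The points of \<open>D\<close> that \<open>f\<close> sends outside \<open>W\<close> cannot accumulate at \<open>a\<close>, for in a
  Frechet-Urysohn space a sequence of them would converge to \<open>a\<close> while its image stays away from
  \<open>g a\<close>.  On the complement of their closure, \<open>g\<close> takes values in the closure of \<open>W\<close>.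
\<close>

lemma continuous_map_sequential_extension:
  assumes FU: "Frechet_Urysohn_space X" and "regular_space Y"
    and D: "D \<subseteq> topspace X" "X closure_of D = topspace X"
    and lim: "\<And>s a. range s \<subseteq> D \<Longrightarrow> limitin X s a sequentially \<Longrightarrow>
                limitin Y (\<lambda>n. f (s n)) (g a) sequentially"
  shows "continuous_map X Y g"
  unfolding continuous_map_eq_topcontinuous_at topcontinuous_at_def
proof (intro ballI conjI allI impI)
  fix a
  assume a: "a \<in> topspace X"
  show "a \<in> topspace X"
    by (fact a)
  have g_top: "g c \<in> topspace Y" if "c \<in> topspace X" for c
  proof -
    obtain s where "range s \<subseteq> D" "limitin X s c sequentially"
      using FU D \<open>c \<in> topspace X\<close> by (rule Frechet_Urysohn_dense_sequence)
    then show ?thesis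
      by (rule limitin_topspace[OF lim])
  qed
  then show "g \<in> topspace X \<rightarrow> topspace Y"
    by blast
  fix V
  assume V: "openin Y V \<and> g a \<in> V"
  then obtain W where W: "openin Y W" "g a \<in> W" "Y closure_of W \<subseteq> V"
  proof -
    have "closedin Y (topspace Y - V)" and "g a \<in> topspace Y - (topspace Y - V)"
      using V g_top[OF a] by auto
    then obtain W where "openin Y W" "g a \<in> W" "disjnt (topspace Y - V) (Y closure_of W)"
      using \<open>regular_space Y\<close> unfolding regular_space by meson
    then show thesis
      using that closure_of_subset_topspace[of Y W] by (auto simp: disjnt_iff)
  qed
  define A where "A = {d \<in> D. f d \<notin> W}"
  define U where "U = topspace X - X closure_of A"
  have "a \<notin> X closure_of A"
  proof
    assume "a \<in> X closure_of A"
    moreover have "A \<subseteq> topspace X"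
      using D(1) by (auto simp: A_def)
    ultimately obtain s where s: "range s \<subseteq> A" "limitin X s a sequentially"
      using FU unfolding Frechet_Urysohn_space_def by meson
    then have "limitin Y (\<lambda>n. f (s n)) (g a) sequentially"
      by (intro lim) (auto simp: A_def)
    then obtain n where "f (s n) \<in> W"
      using W unfolding limitin_sequentially by blast
    then show False
      using s(1) by (auto simp: A_def)
  qed
  then have "a \<in> U"
    using a by (simp add: U_def)
  moreover have "openin X U"
    by (simp add: U_def openin_diff)
  moreover have "g c \<in> V" if "c \<in> U" for c
  proof -
    have "c \<in> topspace X"
      using that by (simp add: U_def)
    with FU D obtain s where s: "range s \<subseteq> D" "limitin X s c sequentially"
      by (rule Frechet_Urysohn_dense_sequence)
    have "\<forall>\<^sub>F n in sequentially. s n \<in> U"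
      using s(2) \<open>openin X U\<close> that by (rule limitinD)
    moreover have "f (s n) \<in> W" if "s n \<in> U" for n
    proof (rule ccontr)
      assume "f (s n) \<notin> W"
      then have "s n \<in> A"
        using s(1) by (auto simp: A_def)
      moreover have "A \<subseteq> X closure_of A"
        using D(1) by (intro closure_of_subset) (auto simp: A_def)
      ultimately show False
        using that by (auto simp: U_def)
    qed
    ultimately have "\<forall>\<^sub>F n in sequentially. f (s n) \<in> W"
      by (auto elim: eventually_mono)
    then have "\<forall>\<^sub>F n in sequentially. f (s n) \<in> Y closure_of W"
      using closure_of_subset[OF openin_subset[OF W(1)]] by (auto elim: eventually_mono)
    then have "g c \<in> Y closure_of W"
      using lim[OF s] by (intro limitin_closedin) auto
    then show ?thesis
      using W(3) by blast
  qed
  ultimately show "\<exists>U. openin X U \<and> a \<in> U \<and> (\<forall>y\<in>U. g y \<in> V)"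
    by blast
qed

theorem mainTheorem6:
  fixes X :: "'a topology" and Y :: "'b topology" and D :: "'a set" and f :: "'a \<Rightarrow> 'b"
  assumes "Frechet_Urysohn_space X"
    and "regular_space Y" and "t1_space Y"
    and "D \<subseteq> topspace X" and "X closure_of D = topspace X"
    and "continuous_map (subtopology X D) Y f"
  shows "(\<exists>g. continuous_map X Y g \<and> (\<forall>x\<in>D. g x = f x)) \<longleftrightarrow>
    (\<forall>x :: nat \<Rightarrow> 'a. range x \<subseteq> D \<and> (\<exists>a. limitin X x a sequentially) \<longrightarrow>
       (\<exists>b. limitin Y (\<lambda>n. f (x n)) b sequentially))"
proof (intro iffI allI impI)
  fix x :: "nat \<Rightarrow> 'a"
  assume "\<exists>g. continuous_map X Y g \<and> (\<forall>x\<in>D. g x = f x)"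
    and x: "range x \<subseteq> D \<and> (\<exists>a. limitin X x a sequentially)"
  then obtain g a where "continuous_map X Y g" and g: "\<And>d. d \<in> D \<Longrightarrow> g d = f d"
    and "limitin X x a sequentially"
    by blast
  then have "limitin Y (g \<circ> x) (g a) sequentially"
    by (intro continuous_map_limit)
  moreover have "g \<circ> x = (\<lambda>n. f (x n))"
    using x g by (auto simp: fun_eq_iff)
  ultimately show "\<exists>b. limitin Y (\<lambda>n. f (x n)) b sequentially"
    by auto
next
  assume "\<forall>x :: nat \<Rightarrow> 'a. range x \<subseteq> D \<and> (\<exists>a. limitin X x a sequentially) \<longrightarrow>
       (\<exists>b. limitin Y (\<lambda>n. f (x n)) b sequentially)"
  then have conv: "\<exists>b. limitin Y (\<lambda>n. f (x n)) b sequentially"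
    if "range x \<subseteq> D" "limitin X x a sequentially" for x :: "nat \<Rightarrow> 'a" and a
    using that by blast
  have Y: "Hausdorff_space Y"
    using assms(2,3) by (rule regular_t1_imp_Hausdorff_space)
  have "\<exists>b. \<forall>s. range s \<subseteq> D \<longrightarrow> limitin X s a sequentially \<longrightarrow>
          limitin Y (\<lambda>n. f (s n)) b sequentially" for a
  proof (cases "\<exists>s. range s \<subseteq> D \<and> limitin X s a sequentially")
    case True
    then obtain s where s: "range s \<subseteq> D" "limitin X s a sequentially"
      by blast
    then obtain b where b: "limitin Y (\<lambda>n. f (s n)) b sequentially"
      using conv by blast
    have "limitin Y (\<lambda>n. f (t n)) b sequentially"
      if "range t \<subseteq> D" "limitin X t a sequentially" for t
      using sequential_limit_independent[OF Y _ s that b] conv by blast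
    then show ?thesis
      by blast
  qed blast
  then obtain g where g: "\<And>s a. range s \<subseteq> D \<Longrightarrow> limitin X s a sequentially \<Longrightarrow>
                            limitin Y (\<lambda>n. f (s n)) (g a) sequentially"
    by metis
  have "continuous_map X Y g"
    using assms(1,2,4,5) g by (rule continuous_map_sequential_extension)
  moreover have "g d = f d" if "d \<in> D" for d
  proof -
    have "limitin Y (\<lambda>n. f d) (g d) sequentially"
      using that assms(4) by (intro g) auto
    moreover have "f d \<in> topspace Y"
      using that assms(4,6) by (auto simp: continuous_map_def)
    then have "limitin Y (\<lambda>n. f d) (f d) sequentially"
      by simp
    ultimately show ?thesis
      by (rule limitin_Hausdorff_unique[OF _ _ trivial_limit_sequentially Y])
  qed
  ultimately show "\<exists>g. continuous_map X Y g \<and> (\<forall>x\<in>D. g x = f x)"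
    by blast
qed

end
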